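(* Let $(X,L,\tau,l)$ be a labelled Markov chain, $\varphi\in\mathcal{L}$ a formula and $x,y\in X$. Then there exists a proof tree built from the rules (zero), (symm), (weak), (lab), (exp) with $x\mathrel{\#_{\varepsilon}}y$ at its root, where $\varepsilon=|[\![\varphi]\!](x)-[\![\varphi]\!](y)|$.
   Context: A labelled Markov chain (LMC) $(X,L,\tau,l)$ consists of a set of states $X$, a non-empty set of labels $L$, a transition function $\tau\colon X\to\mathcal{D}_{\mathbb{Q}}(X)$ where $\mathcal{D}_{\mathbb{Q}}(X)$ is the set of finitely supported distributions $\mu\colon X\to[0,1]\cap\mathbb{Q}$ with $\sum_x\mu(x)=1$, and a labelling $l\colon X\to L$. For a distribution $\mu$ and a function $h$ defined on a set containing $\operatorname{supp}(\mu)$, $\mu\models h:=\sum_{z\in\operatorname{supp}(\mu)}\mu(z)h(z)$. The logic $\mathcal{L}$ has syntax $\varphi::=a\mid\bigcirc\varphi\mid\neg\varphi\mid\varphi\ominus q\mid\varphi\vee\varphi$ with $a\in L$, $q\in[0,1]\cap\mathbb{Q}$, and semantics $[\![\cdot]\!]\colon\mathcal{L}\to(X\to[0,1]\cap\mathbb{Q})$: $[\![a]\!](x)=1$ if $l(x)=a$ and $0$ otherwise; $[\![\bigcirc\varphi]\!](x)=\tau(x)\models[\![\varphi]\!]$; $[\![\neg\varphi]\!](x)=1-[\![\varphi]\!](x)$; $[\![\varphi\ominus q]\!](x)=\max(0,[\![\varphi]\!](x)-q)$; $[\![\varphi\vee\psi]\!](x)=\max([\![\varphi]\!](x),[\![\psi]\!](x))$.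 Derivation rules, with judgments $x\mathrel{\#_{\varepsilon}}y$ for $x,y\in X$, $\varepsilon\in[0,1]\cap\mathbb{Q}$, and $\mathcal{S}=\mathcal{S}_{x,y}:=\operatorname{supp}(\tau(x))\cup\operatorname{supp}(\tau(y))$: (zero): $x\mathrel{\#_0}y$ with no premises. (symm): from $y\mathrel{\#_{\varepsilon}}x$ infer $x\mathrel{\#_{\varepsilon}}y$. (weak): from $x\mathrel{\#_{\varepsilon'}}y$ and $\varepsilon\le\varepsilon'$ infer $x\mathrel{\#_{\varepsilon}}y$. (lab): if $l(x)\neq l(y)$ infer $x\mathrel{\#_1}y$. (exp): given a map $h\colon\mathcal{S}\to[0,1]\cap\mathbb{Q}$, proofs of $x'\mathrel{\#_{h(x')-h(y')}}y'$ for all $x',y'\in\mathcal{S}$ with $h(x')>h(y')$, and $\tau(x)\models h-\tau(y)\models h\ge\varepsilon$, infer $x\mathrel{\#_{\varepsilon}}y$. Proof trees are finite trees built from these rules. *)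

theory Defs
  imports Complex_Main
begin

definition supp :: "('x \<Rightarrow> rat) \<Rightarrow> 'x set" where
  "supp \<mu> = {z. \<mu> z \<noteq> 0}"

definition rat_dist :: "('x \<Rightarrow> rat) \<Rightarrow> bool" where
  "rat_dist \<mu> \<longleftrightarrow>
     finite (supp \<mu>) \<and> (\<forall>z. \<mu> z \<in> {0..1}) \<and> (\<Sum>z\<in>supp \<mu>. \<mu> z) = 1"

text \<open>
  The states are the elements of the type \<open>'x\<close> and the labels those of \<open>'l\<close>;
  non-emptiness of the set of labels is therefore automatic.
\<close>

definition lmc :: "('x \<Rightarrow> 'x \<Rightarrow> rat) \<Rightarrow> ('x \<Rightarrow> 'l) \<Rightarrow> bool" where
  "lmc \<tau> l \<longleftrightarrow> (\<forall>x. rat_dist (\<tau> x))"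

definition expect :: "('x \<Rightarrow> rat) \<Rightarrow> ('x \<Rightarrow> rat) \<Rightarrow> rat"  (infix "\<Turnstile>" 68) where
  "\<mu> \<Turnstile> h = (\<Sum>z\<in>supp \<mu>. \<mu> z * h z)"

datatype 'l fm =
    Atom 'l
  | Next "'l fm"
  | Neg "'l fm"
  | Minus "'l fm" rat
  | Disj "'l fm" "'l fm"

text \<open>
  The datatype admits arbitrary rationals as subtrahends; the formulas of the logic are
  those whose subtrahends all lie in the unit interval.
\<close>

primrec formula :: "'l fm \<Rightarrow> bool" where
  "formula (Atom a) \<longleftrightarrow> True"
| "formula (Next \<phi>) \<longleftrightarrow> formula \<phi>"
| "formula (Neg \<phi>) \<longleftrightarrow> formula \<phi>"
| "formula (Minus \<phi> q) \<longleftrightarrow> formula \<phi> \<and> q \<in> {0..1}"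
| "formula (Disj \<phi> \<psi>) \<longleftrightarrow> formula \<phi> \<and> formula \<psi>"

primrec sem :: "('x \<Rightarrow> 'x \<Rightarrow> rat) \<Rightarrow> ('x \<Rightarrow> 'l) \<Rightarrow> 'l fm \<Rightarrow> 'x \<Rightarrow> rat" where
  "sem \<tau> l (Atom a) = (\<lambda>x. if l x = a then 1 else 0)"
| "sem \<tau> l (Next \<phi>) = (\<lambda>x. \<tau> x \<Turnstile> sem \<tau> l \<phi>)"
| "sem \<tau> l (Neg \<phi>) = (\<lambda>x. 1 - sem \<tau> l \<phi> x)"
| "sem \<tau> l (Minus \<phi> q) = (\<lambda>x. max 0 (sem \<tau> l \<phi> x - q))"
| "sem \<tau> l (Disj \<phi> \<psi>) = (\<lambda>x. max (sem \<tau> l \<phi> x) (sem \<tau> l \<psi> x))"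

lemma sem_range:
  assumes "lmc \<tau> l" "formula \<phi>"
  shows "sem \<tau> l \<phi> x \<in> {0..1}"
  using assms(2)
proof (induction \<phi> arbitrary: x)
  case (Next \<phi>)
  have d: "rat_dist (\<tau> x)" using assms(1) by (simp add: lmc_def)
  have r: "0 \<le> sem \<tau> l \<phi> z" "sem \<tau> l \<phi> z \<le> 1" for z
    using Next by simp_all
  have p: "0 \<le> \<tau> x z" for z using d by (simp add: rat_dist_def)
  have "(\<Sum>z\<in>supp (\<tau> x). \<tau> x z * sem \<tau> l \<phi> z) \<le> (\<Sum>z\<in>supp (\<tau> x). \<tau> x z)"
    by (intro sum_mono mult_left_le r p)
  then have "\<tau> x \<Turnstile> sem \<tau> l \<phi> \<le> 1" using d by (simp add: expect_def rat_dist_def)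
  moreover have "0 \<le> \<tau> x \<Turnstile> sem \<tau> l \<phi>"
    unfolding expect_def by (intro sum_nonneg mult_nonneg_nonneg r p)
  ultimately show ?case by simp
next
  case (Minus \<phi> q)
  then have "sem \<tau> l \<phi> x \<le> 1" "0 \<le> q" by auto
  then show ?case by simp
next
  case (Disj \<phi> \<psi>)
  then show ?case by (simp add: le_max_iff_disj)
qed simp_all

text \<open>\<open>Apart x \<epsilon> y\<close> is the judgement \<open>x #\<^sub>\<epsilon> y\<close>.\<close>

datatype 'x judgement = Apart 'x rat 'x

text \<open>
  \<open>rule_inst \<tau> l P c\<close>: the set \<open>P\<close> of premises and the conclusion \<open>c\<close> form an instance
  of one of the rules. A map \<open>h\<close> on the joint support \<open>S\<close> is encoded as a total function
  whose values outside \<open>S\<close> are irrelevant: only its restriction to \<open>S\<close> occurs in \<open>exp\<close>.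
\<close>

inductive rule_inst ::
  "('x \<Rightarrow> 'x \<Rightarrow> rat) \<Rightarrow> ('x \<Rightarrow> 'l) \<Rightarrow> 'x judgement set \<Rightarrow> 'x judgement \<Rightarrow> bool"
  for \<tau> :: "'x \<Rightarrow> 'x \<Rightarrow> rat" and l :: "'x \<Rightarrow> 'l" where
  zero: "rule_inst \<tau> l {} (Apart x 0 y)"
| symm: "\<epsilon> \<in> {0..1} \<Longrightarrow> rule_inst \<tau> l {Apart y \<epsilon> x} (Apart x \<epsilon> y)"
| weak: "\<lbrakk>\<epsilon> \<in> {0..1}; \<epsilon>' \<in> {0..1}; \<epsilon> \<le> \<epsilon>'\<rbrakk> \<Longrightarrow>
    rule_inst \<tau> l {Apart x \<epsilon>' y} (Apart x \<epsilon> y)"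
| lab: "l x \<noteq> l y \<Longrightarrow> rule_inst \<tau> l {} (Apart x 1 y)"
| exp: "\<lbrakk>S = supp (\<tau> x) \<union> supp (\<tau> y);
     \<forall>z\<in>S. h z \<in> {0..1};
     \<epsilon> \<in> {0..1};
     (\<tau> x \<Turnstile> h) - (\<tau> y \<Turnstile> h) \<ge> \<epsilon>\<rbrakk> \<Longrightarrow>
    rule_inst \<tau> l {Apart x' (h x' - h y') y' | x' y'. x' \<in> S \<and> y' \<in> S \<and> h x' > h y'}
      (Apart x \<epsilon> y)"

text \<open>Trees of this type are finite, since every node carries a list of subtrees.\<close>

datatype 'x jtree = Node (concl: "'x judgement") (subtrees: "'x jtree list")

inductive proof_tree :: "('x \<Rightarrow> 'x \<Rightarrow> rat) \<Rightarrow> ('x \<Rightarrow> 'l) \<Rightarrow> 'x jtree \<Rightarrow> bool"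
  for \<tau> :: "'x \<Rightarrow> 'x \<Rightarrow> rat" and l :: "'x \<Rightarrow> 'l" where
  "\<lbrakk>rule_inst \<tau> l (concl ` set ts) c; \<forall>t\<in>set ts. proof_tree \<tau> l t\<rbrakk> \<Longrightarrow>
    proof_tree \<tau> l (Node c ts)"

end

theory Submission
  imports Defs
begin

text \<open>Structural induction on the formula, for all pairs of states at once. The key case is
  \<open>Next \<phi>\<close>: take the interpretation of \<open>\<phi>\<close> itself as the map
  \<open>h\<close> in rule \<open>exp\<close>. The premises are then instances of the induction
  hypothesis, and the difference of the two expectations is the difference of the values of
  \<open>Next \<phi>\<close>. An atom is settled by \<open>zero\<close> or \<open>lab\<close>;
  negation preserves distances; truncated subtraction and maximum do not expand them, so
  \<open>weak\<close> suffices. Finite supports keep the tree finitely branching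
  (\<open>derivable_rule\<close>, \<open>derivable_exp\<close>).\<close>

definition derivable :: "('x \<Rightarrow> 'x \<Rightarrow> rat) \<Rightarrow> ('x \<Rightarrow> 'l) \<Rightarrow> 'x judgement \<Rightarrow> bool" where
  "derivable \<tau> l j \<longleftrightarrow> (\<exists>t. proof_tree \<tau> l t \<and> concl t = j)"

text \<open>Choose a derivation for each premise and list them below a new root. Finiteness of
  \<open>P\<close> is what makes such a list exist.\<close>

lemma derivable_rule:
  assumes "rule_inst \<tau> l P c" and "finite P" and "\<And>j. j \<in> P \<Longrightarrow> derivable \<tau> l j"
  shows "derivable \<tau> l c"
proof -
  obtain f where f: "\<And>j. j \<in> P \<Longrightarrow> proof_tree \<tau> l (f j) \<and> concl (f j) = j"
    using assms(3) unfolding derivable_def by metis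
  obtain js where js: "set js = P"
    using finite_list[OF assms(2)] by blast
  have "concl ` set (map f js) = P"
    using f js by force
  then have "proof_tree \<tau> l (Node c (map f js))"
    using assms(1) f js by (auto intro!: proof_tree.intros)
  then show ?thesis
    unfolding derivable_def by force
qed

lemma derivable_symm:
  assumes "\<epsilon> \<in> {0..1}" and "derivable \<tau> l (Apart y \<epsilon> x)"
  shows "derivable \<tau> l (Apart x \<epsilon> y)"
  using rule_inst.symm[OF assms(1)] by (rule derivable_rule) (use assms in auto)

lemma derivable_weak:
  assumes "derivable \<tau> l (Apart x \<epsilon>' y)" and "0 \<le> \<epsilon>" and "\<epsilon> \<le> \<epsilon>'" and "\<epsilon>' \<le> 1"
  shows "derivable \<tau> l (Apart x \<epsilon> y)"
proof -
  have "rule_inst \<tau> l {Apart x \<epsilon>' y} (Apart x \<epsilon> y)"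
    using assms by (intro rule_inst.weak) auto
  then show ?thesis
    by (rule derivable_rule) (use assms in auto)
qed

text \<open>The premises are indexed by pairs from the joint support, hence finite in number. The
  map \<open>h\<close> is constrained on all states because it will be the interpretation of a
  formula.\<close>

lemma derivable_exp:
  assumes "finite (supp (\<tau> x))" and "finite (supp (\<tau> y))"
    and "\<And>z. h z \<in> {0..1}"
    and "\<epsilon> \<in> {0..1}" and "(\<tau> x \<Turnstile> h) - (\<tau> y \<Turnstile> h) \<ge> \<epsilon>"
    and prem: "\<And>x' y'. h x' > h y' \<Longrightarrow> derivable \<tau> l (Apart x' (h x' - h y') y')"
  shows "derivable \<tau> l (Apart x \<epsilon> y)"
proof -
  let ?S = "supp (\<tau> x) \<union> supp (\<tau> y)"
  let ?P = "{Apart x' (h x' - h y') y' | x' y'. x' \<in> ?S \<and> y' \<in> ?S \<and> h x' > h y'}"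
  have "rule_inst \<tau> l ?P (Apart x \<epsilon> y)"
    by (rule rule_inst.exp[OF refl]) (use assms in auto)
  moreover have "finite ?P"
    by (rule finite_subset[of _ "(\<lambda>(x', y'). Apart x' (h x' - h y') y') ` (?S \<times> ?S)"])
      (use assms in auto)
  ultimately show ?thesis
    by (rule derivable_rule) (use prem in auto)
qed

lemma abs_diff_le_1:
  fixes a b :: rat
  assumes "a \<in> {0..1}" and "b \<in> {0..1}"
  shows "\<bar>a - b\<bar> \<le> 1"
  using assms by auto

text \<open>If the larger maximum is attained at \<open>a\<close>, say, replacing the other maximum
  by \<open>c\<close> can only widen the gap. The disjunction tells which disjunct's derivation to
  weaken.\<close>

lemma abs_max_diff_le:
  fixes a b c d :: rat
  shows "\<bar>max a b - max c d\<bar> \<le> \<bar>a - c\<bar> \<or> \<bar>max a b - max c d\<bar> \<le> \<bar>b - d\<bar>"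
  by (cases "a \<le> b"; cases "c \<le> d"; simp add: max_def; linarith)

lemma derivable_sem:
  assumes "lmc \<tau> l" and "formula \<phi>"
  shows "derivable \<tau> l (Apart x \<bar>sem \<tau> l \<phi> x - sem \<tau> l \<phi> y\<bar> y)"
  using assms(2)
proof (induction \<phi> arbitrary: x y)
  case (Atom a)
  show ?case
  proof (cases "l x = l y")
    case True
    then show ?thesis
      using derivable_rule[OF rule_inst.zero] by simp
  next
    case False
    then have "derivable \<tau> l (Apart x 1 y)"
      using derivable_rule[OF rule_inst.lab] by simp
    \<comment> \<open>The atom \<open>a\<close> may differ from both labels, so the distance is 0 or
      1.\<close>
    then show ?thesis
      by (rule derivable_weak) auto
  qed
next
  case (Next \<phi>)
  let ?h = "sem \<tau> l \<phi>" and ?f = "sem \<tau> l (Next \<phi>)"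
  have fin: "finite (supp (\<tau> z))" for z
    using assms(1) by (simp add: lmc_def rat_dist_def)
  have h: "?h z \<in> {0..1}" for z
    using sem_range[OF assms(1)] Next.prems by simp
  have f: "?f z \<in> {0..1}" for z
    using sem_range[OF assms(1) Next.prems] .
  \<comment> \<open>Rule \<open>exp\<close> bounds a signed difference, so the states are first
    ordered by value; the other order follows by \<open>symm\<close>.\<close>
  have *: "derivable \<tau> l (Apart x \<bar>?f x - ?f y\<bar> y)" if "?f y \<le> ?f x" for x y
  proof (rule derivable_exp[OF fin fin h])
    show "\<bar>?f x - ?f y\<bar> \<in> {0..1}"
      using abs_diff_le_1[OF f f] by simp
    show "\<bar>?f x - ?f y\<bar> \<le> (\<tau> x \<Turnstile> ?h) - (\<tau> y \<Turnstile> ?h)"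
      using that by simp
    \<comment> \<open>The strict inequality removes the absolute value in the induction
      hypothesis.\<close>
    show "derivable \<tau> l (Apart x' (?h x' - ?h y') y')" if "?h y' < ?h x'" for x' y'
      using Next.IH[of x' y'] Next.prems that by simp
  qed
  show ?case
  proof (cases "?f y \<le> ?f x")
    case True
    then show ?thesis by (rule *)
  next
    case False
    have "derivable \<tau> l (Apart y \<bar>?f y - ?f x\<bar> x)"
      by (rule *) (use False in simp)
    then have "derivable \<tau> l (Apart y \<bar>?f x - ?f y\<bar> x)"
      by (simp only: abs_minus_commute)
    then show ?thesis
      by (rule derivable_symm[rotated]) (use abs_diff_le_1[OF f f] in auto)
  qed
next
  case (Neg \<phi>)
  then show ?case
    by (simp add: abs_minus_commute)
next
  case (Minus \<phi> q)
  have b: "\<bar>sem \<tau> l \<phi> x - sem \<tau> l \<phi> y\<bar> \<le> 1"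
    using Minus.prems by (intro abs_diff_le_1 sem_range assms(1)) auto
  show ?case
    \<comment> \<open>The map sending t to max 0 (t - q) is 1-Lipschitz.\<close>
    by (rule derivable_weak[OF Minus.IH abs_ge_zero _ b])
      (use Minus.prems in \<open>auto simp: max_def\<close>)
next
  case (Disj \<phi> \<psi>)
  let ?f = "sem \<tau> l \<phi>" and ?g = "sem \<tau> l \<psi>" and ?m = "sem \<tau> l (Disj \<phi> \<psi>)"
  have b: "\<bar>?f x - ?f y\<bar> \<le> 1" "\<bar>?g x - ?g y\<bar> \<le> 1"
    using Disj.prems by (intro abs_diff_le_1 sem_range assms(1); simp)+
  consider "\<bar>?m x - ?m y\<bar> \<le> \<bar>?f x - ?f y\<bar>" | "\<bar>?m x - ?m y\<bar> \<le> \<bar>?g x - ?g y\<bar>"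
    using abs_max_diff_le by fastforce
  then show ?case
  proof cases
    case 1
    show ?thesis
      by (rule derivable_weak[OF Disj.IH(1) abs_ge_zero 1 b(1)]) (use Disj.prems in simp)
  next
    case 2
    show ?thesis
      by (rule derivable_weak[OF Disj.IH(2) abs_ge_zero 2 b(2)]) (use Disj.prems in simp)
  qed
qed

theorem theorem17:
  fixes \<tau> :: "'x \<Rightarrow> 'x \<Rightarrow> rat" and l :: "'x \<Rightarrow> 'l" and \<phi> :: "'l fm" and x y :: 'x
  assumes "lmc \<tau> l" and "formula \<phi>"
  shows "\<exists>t. proof_tree \<tau> l t \<and> concl t = Apart x \<bar>sem \<tau> l \<phi> x - sem \<tau> l \<phi> y\<bar> y"
  using derivable_sem[OF assms] unfolding derivable_def .

end
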